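(* Let $\Gamma=(V,E)$ be a finite, undirected, weighted, connected graph with $N\ge 2$ vertices (loops allowed), let $l\ge1$ be an integer, and let $\mathcal{A}[l]$ be a real number with $\mathcal{A}[l]\le\lambda_1[l]$, where $\lambda_1[l]$ is the second smallest eigenvalue (counted with multiplicity) of the normalized Laplace operator $\Delta[l]$ of the neighborhood graph $\Gamma[l]$. Then the eigenvalues $0=\lambda_0<\lambda_1\le\dots\le\lambda_{N-1}$ of the normalized Laplace operator $\Delta$ of $\Gamma$ satisfy $$1-(1-\mathcal{A}[l])^{1/l}\le\lambda_1\le\dots\le\lambda_{N-1}\le 1+(1-\mathcal{A}[l])^{1/l}\quad\text{if } l \text{ is even},$$ and $$1-(1-\mathcal{A}[l])^{1/l}\le\lambda_1\quad\text{if } l\text{ is odd}.$$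
   Context: The weight function $w:V\times V\to\mathbb{R}$ satisfies $w_{ij}=w_{ji}$, $w_{ij}>0$ if $i\sim j$ (i.e. $i,j$ are joined by an edge; $i=j$ allowed, a loop) and $w_{ij}=0$ otherwise. The degree is $d_i=\sum_{j}w_{ij}$, and $\Delta v(i)=\frac{1}{d_i}\sum_j w_{ij}(v(i)-v(j))$ for $v:V\to\mathbb{R}$. The neighborhood graph $\Gamma[l]$ is the weighted graph on the same vertex set $V$ with weights $w_{ij}[1]=w_{ij}$ and, for $l>1$, $$w_{ij}[l]=\sum_{k_1,\dots,k_{l-1}\in V}\frac{1}{d_{k_1}}\cdots\frac{1}{d_{k_{l-1}}}w_{ik_1}w_{k_1k_2}\cdots w_{k_{l-1}j};$$ with $d_i[l]=\sum_j w_{ij}[l]$, its normalized Laplace operator is $\Delta[l]v(i)=\frac{1}{d_i[l]}\sum_j w_{ij}[l](v(i)-v(j))$, with eigenvalues $0=\lambda_0[l]\le\lambda_1[l]\le\dots\le\lambda_{N-1}[l]$ counted with multiplicity. For even $l$, all these eigenvalues are $\le 1$, so $1-\mathcal{A}[l]\ge0$ and its nonnegative $l$-th root is taken. For odd $l$, $x^{1/l}$ denotes the real $l$-th root (also for negative $x$). *)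

theory Defs
  imports "HOL-Analysis.Analysis" "HOL-Library.Multiset"
begin

text \<open>
  The vertex set is the finite type \<open>'v\<close>. An undirected edge set is a symmetric relation;
  a loop at \<open>i\<close> is the pair \<open>(i, i)\<close>.
\<close>

definition weighted_graph :: "('v::finite \<times> 'v) set \<Rightarrow> ('v \<Rightarrow> 'v \<Rightarrow> real) \<Rightarrow> bool" where
  "weighted_graph E w \<longleftrightarrow>
     sym E \<and> (\<forall>i j. w i j = w j i) \<and>
     (\<forall>i j. (i, j) \<in> E \<longrightarrow> w i j > 0) \<and> (\<forall>i j. (i, j) \<notin> E \<longrightarrow> w i j = 0)"

definition connected_graph :: "('v \<times> 'v) set \<Rightarrow> bool" where
  "connected_graph E \<longleftrightarrow> (\<forall>i j. (i, j) \<in> E\<^sup>*)"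

definition degree :: "('v::finite \<Rightarrow> 'v \<Rightarrow> real) \<Rightarrow> 'v \<Rightarrow> real" where
  "degree w i = (\<Sum>j\<in>UNIV. w i j)"

definition laplace :: "('v::finite \<Rightarrow> 'v \<Rightarrow> real) \<Rightarrow> real ^ 'v \<Rightarrow> real ^ 'v" where
  "laplace w v = (\<chi> i. 1 / degree w i * (\<Sum>j\<in>UNIV. w i j * (v $ i - v $ j)))"

text \<open>
  The list \<open>ks\<close> is the tuple \<open>k\<^sub>1, \<dots>, k\<^sub>l\<^sub>-\<^sub>1\<close> of inner vertices of the walk
  \<open>i # ks @ [j]\<close>. For \<open>l = 1\<close> only \<open>ks = []\<close> occurs, and the sum is \<open>w i j\<close>.
  The value at \<open>l = 0\<close> has no meaning.
\<close>

definition nbhd_weight :: "('v::finite \<Rightarrow> 'v \<Rightarrow> real) \<Rightarrow> nat \<Rightarrow> 'v \<Rightarrow> 'v \<Rightarrow> real" where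
  "nbhd_weight w l i j =
     (\<Sum>ks | length ks = l - 1.
        (\<Prod>k\<leftarrow>ks. 1 / degree w k) *
        (\<Prod>m<l. w ((i # ks @ [j]) ! m) ((i # ks @ [j]) ! Suc m)))"

definition eigenspace :: "(real ^ 'v::finite \<Rightarrow> real ^ 'v) \<Rightarrow> real \<Rightarrow> (real ^ 'v) set" where
  "eigenspace L x = {v. L v = x *\<^sub>R v}"

definition eigenvalues :: "(real ^ 'v::finite \<Rightarrow> real ^ 'v) \<Rightarrow> real set" where
  "eigenvalues L = {x. \<exists>v\<in>eigenspace L x. v \<noteq> 0}"

text \<open>
  The eigenvalues in increasing order, each repeated according to its geometric multiplicity.
  The Laplace operator is self-adjoint for the degree-weighted inner product, so this is also
  the algebraic multiplicity.
\<close>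

definition spectrum_list :: "(real ^ 'v::finite \<Rightarrow> real ^ 'v) \<Rightarrow> real list" where
  "spectrum_list L =
     sorted_list_of_multiset
       (\<Sum>x\<in>eigenvalues L. replicate_mset (dim (eigenspace L x)) x)"

end

theory Submission
  imports Defs
begin

text \<open>
  Let \<open>P\<close> be the transition operator of the random walk, so that \<open>\<Delta> = 1 - P\<close>. The weights
  of the neighborhood graph are \<open>w[l] = D P\<^sup>l\<close>, and the degrees do not change, hence
  \<open>\<Delta>[l] = 1 - P\<^sup>l\<close>. Conjugation by \<open>D\<^sup>1\<^sup>/\<^sup>2\<close> makes \<open>P\<close> symmetric, so \<open>P\<close> has a basis of
  eigenvectors; in the same basis \<open>\<Delta>\<close> has the eigenvalues \<open>1 - \<rho>\<close> and \<open>\<Delta>[l]\<close> the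
  eigenvalues \<open>1 - \<rho>\<^sup>l\<close>. All \<open>\<rho>\<close> lie in \<open>[-1, 1]\<close>, and by connectedness only the constant
  functions have \<open>\<rho> = 1\<close>. Removing one eigenvalue 0 from the spectrum of \<open>\<Delta>[l]\<close> leaves
  \<open>\<lambda>\<^sub>1[l]\<close> as the minimum of the \<open>1 - \<rho>\<^sup>l\<close> over the other basis vectors, whether or not
  \<open>\<Gamma>[l]\<close> is connected. So \<open>\<rho>\<^sup>l \<le> 1 - A\<close> for all of them, and the bounds follow by taking roots.
\<close>

section \<open>Diagonalization of self-adjoint operators\<close>

text \<open>The form \<open>x \<bullet> f x\<close> attains its maximum on the compact unit sphere
  of \<open>S\<close>, and a maximizer is an eigenvector. The lemma is stated for an invariant
  subspace so that it applies to the orthogonal complement of all eigenvectors.\<close>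

lemma selfadjoint_eigenvector_exists:
  fixes f :: "'a::euclidean_space \<Rightarrow> 'a"
  assumes lin: "linear f" and sa: "\<And>x y. f x \<bullet> y = x \<bullet> f y"
    and S: "subspace S" and inv: "\<And>x. x \<in> S \<Longrightarrow> f x \<in> S" and ne: "S \<noteq> {0}"
  shows "\<exists>u\<in>S. u \<noteq> 0 \<and> (\<exists>c. f u = c *\<^sub>R u)"
proof -
  obtain z where z: "z \<in> S" "z \<noteq> 0"
    using ne subspace_0[OF S] by blast
  let ?K = "S \<inter> sphere 0 1"
  have "compact ?K"
    using closed_subspace[OF S] by (simp add: closed_Int_compact)
  moreover have "z /\<^sub>R norm z \<in> ?K"
    using z S by (simp add: subspace_scale)
  moreover have "continuous_on ?K (\<lambda>x. x \<bullet> f x)"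
    using lin by (intro continuous_intros linear_continuous_on) (simp add: linear_conv_bounded_linear)
  ultimately obtain u where u: "u \<in> ?K" and max: "\<And>y. y \<in> ?K \<Longrightarrow> y \<bullet> f y \<le> u \<bullet> f u"
    using continuous_attains_sup[of ?K "\<lambda>x. x \<bullet> f x"] by blast
  define M where "M = u \<bullet> f u"
  define q where "q x = M * (x \<bullet> x) - x \<bullet> f x" for x
  \<comment> \<open>\<open>q\<close> is nonnegative on \<open>S\<close> and vanishes at the maximizer \<open>u\<close> of the Rayleigh quotient, so
    its first-order term in the direction of \<open>f u - M u\<close> must vanish.\<close>
  have q_nonneg: "0 \<le> q x" if "x \<in> S" for x
  proof (cases "x = 0")
    case False
    let ?n = "norm x"
    have "(x /\<^sub>R ?n) \<bullet> f (x /\<^sub>R ?n) \<le> M"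
      unfolding M_def using that False S by (intro max) (simp add: subspace_scale)
    then have "x \<bullet> f x \<le> M * ?n\<^sup>2"
      using False by (simp add: linear_scale[OF lin] divide_simps power2_eq_square mult.commute)
    then show ?thesis
      by (simp add: q_def power2_norm_eq_inner)
  qed (simp add: q_def)
  have uS: "u \<in> S" and uu: "u \<bullet> u = 1"
    using u by (simp_all add: norm_eq_1)
  define y where "y = f u - M *\<^sub>R u"
  have yS: "y \<in> S"
    unfolding y_def using uS by (intro subspace_diff subspace_scale S inv)
  have expand: "q (u + t *\<^sub>R y) = t\<^sup>2 * q y - 2 * t * (y \<bullet> y)" for t
  proof -
    have yfu: "y \<bullet> f u = y \<bullet> y + M * (y \<bullet> u)"
      by (subst (3) y_def) (simp add: inner_diff_right)
    have ufy: "u \<bullet> f y = y \<bullet> f u"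
      using sa[of u y] by (simp add: inner_commute)
    show ?thesis
      unfolding q_def
      by (simp add: linear_add[OF lin] linear_scale[OF lin] inner_add_left inner_add_right
          inner_commute[of u y] ufy yfu M_def[symmetric] uu algebra_simps power2_eq_square)
  qed
  have ineq: "0 \<le> t\<^sup>2 * q y - 2 * t * (y \<bullet> y)" for t
    using q_nonneg[of "u + t *\<^sub>R y"] uS yS S by (simp add: expand subspace_add subspace_scale)
  have "y \<bullet> y = 0"
  proof (rule ccontr)
    assume "y \<bullet> y \<noteq> 0"
    then have pos: "y \<bullet> y > 0"
      by simp
    \<comment> \<open>The value \<open>t = 1\<close> forces \<open>q y > 0\<close>. Then
      \<open>t = (y \<bullet> y) / q y\<close> is the minimizer of the quadratic in
      \<open>ineq\<close>, where its value would be negative.\<close>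
    have "2 * (y \<bullet> y) \<le> q y"
      using ineq[of 1] by simp
    then have "q y > 0"
      using pos by linarith
    then have "(y \<bullet> y) * (y \<bullet> y) \<le> 0"
      using ineq[of "(y \<bullet> y) / q y"] by (simp add: power2_eq_square divide_simps)
    then show False
      using mult_pos_pos[OF pos pos] by linarith
  qed
  then have "f u = M *\<^sub>R u"
    by (simp add: y_def)
  moreover have "u \<noteq> 0"
    using uu by auto
  ultimately show ?thesis
    using uS by blast
qed

text \<open>The orthogonal complement of all eigenvectors is invariant by self-adjointness. Were it
  nonzero, it would contain an eigenvector, which is then orthogonal to itself. So the eigenvectors
  span, and any maximal independent set of them is a basis; orthogonality of the basis is not
  claimed.\<close>

lemma selfadjoint_eigenbasis_exists:
  fixes f :: "'a::euclidean_space \<Rightarrow> 'a"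
  assumes lin: "linear f" and sa: "\<And>x y. f x \<bullet> y = x \<bullet> f y"
  obtains B \<rho> where "independent B" "span B = UNIV" "\<And>b. b \<in> B \<Longrightarrow> f b = \<rho> b *\<^sub>R b"
proof -
  let ?Eig = "{v. \<exists>c. f v = c *\<^sub>R v}"
  let ?S = "{y. \<forall>x\<in>?Eig. orthogonal x y}"
  have inv: "f y \<in> ?S" if y: "y \<in> ?S" for y
  proof -
    have "x \<bullet> f y = 0" if x: "f x = c *\<^sub>R x" for x c
    proof -
      have "x \<bullet> y = 0"
        using y x unfolding orthogonal_def by blast
      then show ?thesis
        using sa[of x y] by (simp add: x)
    qed
    then show ?thesis
      unfolding orthogonal_def by blast
  qed
  have trivial: "v = 0" if "v \<in> ?S" "f v = c *\<^sub>R v" for v c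
  proof -
    have "orthogonal v v"
      using that by blast
    then show ?thesis
      by (simp add: orthogonal_self)
  qed
  have S_eq: "?S = {0}"
  proof (rule ccontr)
    assume "?S \<noteq> {0}"
    then obtain u where "u \<in> ?S" "u \<noteq> 0" "\<exists>c. f u = c *\<^sub>R u"
      using selfadjoint_eigenvector_exists[OF lin sa subspace_orthogonal_to_vectors inv] by meson
    then show False
      using trivial by meson
  qed
  have "span ?Eig = UNIV"
  proof (rule ccontr)
    assume "span ?Eig \<noteq> UNIV"
    then have "span ?Eig \<subset> span UNIV"
      by auto
    then have "\<exists>x. x \<noteq> 0 \<and> (\<forall>y\<in>span ?Eig. orthogonal x y)"
      by (rule orthogonal_to_subspace_exists_gen) auto
    then obtain x where "x \<noteq> 0" and x: "\<forall>y\<in>span ?Eig. orthogonal x y"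
      by blast
    have "orthogonal y x" if "y \<in> ?Eig" for y
      using bspec[OF x span_base[OF that]] by (simp add: orthogonal_commute)
    then have "x \<in> ?S"
      by blast
    with S_eq \<open>x \<noteq> 0\<close> show False
      by blast
  qed
  moreover obtain B where B: "B \<subseteq> ?Eig" "independent B" "?Eig \<subseteq> span B"
    by (rule maximal_independent_subset)
  ultimately have "span B = UNIV"
    using span_minimal[OF B(3) subspace_span] by (simp add: top.extremum_unique)
  moreover have "\<exists>c. f b = c *\<^sub>R b" if "b \<in> B" for b
    using B(1) that by blast
  then obtain \<rho> where "\<And>b. b \<in> B \<Longrightarrow> f b = \<rho> b *\<^sub>R b"
    by metis
  ultimately show ?thesis
    using that[OF B(2)] by blast
qed

section \<open>The spectrum read off an eigenbasis\<close>

text \<open>Comparing coefficients in \<open>L v = x *\<^sub>R v\<close> shows that an eigenvector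
  for \<open>x\<close> has no component along basis vectors with another eigenvalue.\<close>

lemma eigenspace_eq_span:
  fixes L :: "real ^ 'v::finite \<Rightarrow> real ^ 'v"
  assumes lin: "linear L" and ind: "independent B" and sp: "span B = UNIV"
    and eig: "\<And>b. b \<in> B \<Longrightarrow> L b = \<mu> b *\<^sub>R b"
  shows "eigenspace L x = span {b \<in> B. \<mu> b = x}"
proof
  have fin: "finite B"
    using ind by (rule independent_imp_finite)
  have "subspace (eigenspace L x)"
    by (auto simp: subspace_def eigenspace_def linear_0[OF lin] linear_add[OF lin]
        linear_scale[OF lin] scaleR_add_right)
  then show "span {b \<in> B. \<mu> b = x} \<subseteq> eigenspace L x"
    by (intro span_minimal) (auto simp: eigenspace_def eig)
  show "eigenspace L x \<subseteq> span {b \<in> B. \<mu> b = x}"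
  proof
    fix v assume "v \<in> eigenspace L x"
    then have Lv: "L v = x *\<^sub>R v"
      by (simp add: eigenspace_def)
    define c where "c = representation B v"
    have v: "(\<Sum>b\<in>B. c b *\<^sub>R b) = v"
      unfolding c_def using ind sp fin by (intro sum_representation_eq) auto
    have "L v = (\<Sum>b\<in>B. (c b * \<mu> b) *\<^sub>R b)"
      by (subst v[symmetric]) (simp add: linear_sum[OF lin] linear_scale[OF lin] eig)
    moreover have "x *\<^sub>R v = (\<Sum>b\<in>B. (x * c b) *\<^sub>R b)"
      by (subst v[symmetric]) (simp add: scaleR_sum_right)
    ultimately have "(\<Sum>b\<in>B. (c b * \<mu> b - x * c b) *\<^sub>R b) = 0"
      using Lv by (simp add: scaleR_diff_left sum_subtractf)
    then have "c b * \<mu> b - x * c b = 0" if "b \<in> B" for b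
      using independentD[OF ind fin subset_refl _ that, of "\<lambda>b. c b * \<mu> b - x * c b"] by simp
    then have zero: "c b = 0" if "b \<in> B" "\<mu> b \<noteq> x" for b
      using that by (metis mult.commute mult_cancel_left eq_iff_diff_eq_0)
    have "v = (\<Sum>b | b \<in> B \<and> \<mu> b = x. c b *\<^sub>R b)"
      by (subst v[symmetric], rule sum.mono_neutral_right) (auto simp: fin zero)
    then show "v \<in> span {b \<in> B. \<mu> b = x}"
      by (metis (no_types, lifting) span_base span_scale span_sum)
  qed
qed

lemma image_mset_mset_set_eq_sum:
  assumes "finite B"
  shows "image_mset \<mu> (mset_set B) = (\<Sum>x\<in>\<mu> ` B. replicate_mset (card {b \<in> B. \<mu> b = x}) x)"
proof (rule multiset_eqI)
  fix y
  have "count (\<Sum>x\<in>\<mu> ` B. replicate_mset (card {b \<in> B. \<mu> b = x}) x) y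
      = (\<Sum>x\<in>\<mu> ` B. if x = y then card {b \<in> B. \<mu> b = y} else 0)"
    by (auto simp: count_sum intro!: sum.cong)
  also have "\<dots> = card {b \<in> B. \<mu> b = y}"
    using assms by (auto simp: card_eq_0_iff)
  also have "\<dots> = count (image_mset \<mu> (mset_set B)) y"
    using assms by (simp add: count_image_mset' eq_commute)
  finally show "count (image_mset \<mu> (mset_set B)) y
      = count (\<Sum>x\<in>\<mu> ` B. replicate_mset (card {b \<in> B. \<mu> b = x}) x) y"
    by simp
qed

text \<open>The dimension of each eigenspace is the number of basis vectors carrying that
  eigenvalue. This lets the spectra of both Laplace operators be read off one common basis.\<close>

lemma spectrum_list_eigenbasis:
  fixes L :: "real ^ 'v::finite \<Rightarrow> real ^ 'v"
  assumes "linear L" and ind: "independent B" and "span B = UNIV"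
    and "\<And>b. b \<in> B \<Longrightarrow> L b = \<mu> b *\<^sub>R b"
  shows "spectrum_list L = sorted_list_of_multiset (image_mset \<mu> (mset_set B))"
proof -
  note es = eigenspace_eq_span[OF assms]
  have ind': "independent {b \<in> B. \<mu> b = x}" for x
    using ind by (rule independent_mono) auto
  have "eigenvalues L = \<mu> ` B"
  proof
    show "eigenvalues L \<subseteq> \<mu> ` B"
    proof
      fix x assume "x \<in> eigenvalues L"
      then obtain v where "v \<in> span {b \<in> B. \<mu> b = x}" "v \<noteq> 0"
        by (auto simp: eigenvalues_def es)
      then have "{b \<in> B. \<mu> b = x} \<noteq> {}"
        by (metis singletonD span_empty)
      then show "x \<in> \<mu> ` B"
        by auto
    qed
    have "b \<in> eigenspace L (\<mu> b)" "b \<noteq> 0" if "b \<in> B" for b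
      using that ind dependent_zero by (auto simp: es intro: span_base)
    then show "\<mu> ` B \<subseteq> eigenvalues L"
      by (auto simp: eigenvalues_def)
  qed
  moreover have "dim (eigenspace L x) = card {b \<in> B. \<mu> b = x}" for x
    by (simp add: es dim_eq_card_independent[OF ind'])
  ultimately show ?thesis
    by (simp add: spectrum_list_def image_mset_mset_set_eq_sum[OF independent_imp_finite[OF ind]])
qed

lemma sorted_list_of_multiset_Cons:
  assumes "\<And>x. x \<in># M \<Longrightarrow> a \<le> x"
  shows "sorted_list_of_multiset (add_mset a M) = a # sorted_list_of_multiset M"
  using assms by (simp add: insort_is_Cons)

section \<open>The transition operator\<close>

definition transition :: "('v::finite \<Rightarrow> 'v \<Rightarrow> real) \<Rightarrow> real ^ 'v \<Rightarrow> real ^ 'v" where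
  "transition w v = (\<chi> i. 1 / degree w i * (\<Sum>j\<in>UNIV. w i j * v $ j))"

lemma linear_transition: "linear (transition w)"
  by (rule linearI)
    (auto simp: transition_def vec_eq_iff sum.distrib algebra_simps sum_distrib_left add_divide_distrib)

lemma laplace_eq_transition:
  assumes "\<And>i. degree w i > 0"
  shows "laplace w v = v - transition w v"
proof -
  have "1 / degree w i * (\<Sum>j\<in>UNIV. w i j * (v $ i - v $ j))
      = v $ i - 1 / degree w i * (\<Sum>j\<in>UNIV. w i j * v $ j)" for i
  proof -
    have "(\<Sum>j\<in>UNIV. w i j * (v $ i - v $ j)) = degree w i * v $ i - (\<Sum>j\<in>UNIV. w i j * v $ j)"
      by (simp add: right_diff_distrib sum_subtractf degree_def sum_distrib_right)
    then show ?thesis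
      using assms[of i] by (simp add: field_simps)
  qed
  then show ?thesis
    by (simp add: laplace_def transition_def vec_eq_iff)
qed

lemma transition_one:
  assumes "\<And>i. degree w i > 0"
  shows "transition w 1 = 1"
  using assms by (simp add: transition_def vec_eq_iff degree_def[symmetric] less_imp_neq[symmetric])

lemma transition_eigenbasis_exists:
  fixes w :: "'v::finite \<Rightarrow> 'v \<Rightarrow> real"
  assumes sym: "\<And>i j. w i j = w j i" and pos: "\<And>i. degree w i > 0"
  obtains B \<rho> where "independent B" "span B = UNIV" "\<And>b. b \<in> B \<Longrightarrow> transition w b = \<rho> b *\<^sub>R b"
proof -
  define s where "s i = sqrt (degree w i)" for i
  have s: "s i > 0" "s i * s i = degree w i" for i
    using pos[of i] by (simp_all add: s_def)
  \<comment> \<open>In matrix form \<open>f\<close> is \<open>D\<^sup>-\<^sup>1\<^sup>/\<^sup>2 W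
    D\<^sup>-\<^sup>1\<^sup>/\<^sup>2\<close>, and \<open>T\<close> below is
    \<open>D\<^sup>-\<^sup>1\<^sup>/\<^sup>2\<close>. \<open>T\<close> carries eigenvectors of
    \<open>f\<close> to eigenvectors of the transition operator with the same eigenvalue.\<close>
  define f :: "real ^ 'v \<Rightarrow> real ^ 'v"
    where "f v = (\<chi> i. \<Sum>j\<in>UNIV. w i j / (s i * s j) * v $ j)" for v
  define T :: "real ^ 'v \<Rightarrow> real ^ 'v" where "T v = (\<chi> i. v $ i / s i)" for v
  have "linear f"
    by (rule linearI) (simp_all add: f_def vec_eq_iff distrib_left add_divide_distrib sum.distrib sum_distrib_left mult_ac)
  moreover have "f x \<bullet> y = x \<bullet> f y" for x y
  proof -
    have "f x \<bullet> y = (\<Sum>i\<in>UNIV. \<Sum>j\<in>UNIV. w i j / (s i * s j) * x $ j * y $ i)"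
      by (simp add: inner_vec_def f_def sum_distrib_right)
    also have "\<dots> = (\<Sum>j\<in>UNIV. \<Sum>i\<in>UNIV. w i j / (s i * s j) * x $ j * y $ i)"
      by (rule sum.swap)
    also have "\<dots> = x \<bullet> f y"
      by (simp add: inner_vec_def f_def sum_distrib_left sym mult_ac)
    finally show ?thesis .
  qed
  ultimately obtain C \<sigma> where C: "independent C" "span C = UNIV"
    and eig: "\<And>c. c \<in> C \<Longrightarrow> f c = \<sigma> c *\<^sub>R c"
    using selfadjoint_eigenbasis_exists by metis
  have T: "linear T"
    by (rule linearI) (auto simp: T_def vec_eq_iff add_divide_distrib)
  have injT: "inj T"
  proof (rule injI)
    fix x y assume "T x = T y"
    then have "x $ i / s i = y $ i / s i" for i
      by (simp add: T_def vec_eq_iff)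
    then show "x = y"
      using s(1) by (simp add: vec_eq_iff less_imp_neq[symmetric])
  qed
  have conj: "transition w (T v) = T (f v)" for v
    unfolding transition_def T_def f_def
    by (simp add: vec_eq_iff sum_distrib_left sum_divide_distrib s(2)[symmetric] mult_ac)
  have "independent (T ` C)"
    using T C(1) injT by (simp add: linear_independent_injective_image inj_on_subset)
  moreover have "span (T ` C) = UNIV"
    using linear_injective_imp_surjective[OF T injT] C(2) by (simp add: linear_span_image[OF T])
  moreover have "transition w b = \<sigma> (inv T b) *\<^sub>R b" if "b \<in> T ` C" for b
    using that injT by (auto simp: conj eig linear_scale[OF T])
  ultimately show ?thesis
    by (rule that)
qed

section \<open>Maximum principle: bounds on the eigenvalues and the eigenvalue 1\<close>

lemma finite_type_attains_max:
  fixes g :: "'v::finite \<Rightarrow> real"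
  obtains i where "\<And>j. g j \<le> g i"
proof -
  have "Max (range g) \<in> range g"
    by (intro Max_in) auto
  then obtain i where "Max (range g) = g i"
    by blast
  then show ?thesis
    using that[of i] by (metis Max_ge finite finite_imageI rangeI)
qed

text \<open>At a vertex where \<open>v\<close> is largest in absolute value, the weighted average of
  \<open>v\<close> over the neighbors cannot exceed that value in size.\<close>

lemma transition_eigenvalue_abs_le_1:
  fixes w :: "'v::finite \<Rightarrow> 'v \<Rightarrow> real"
  assumes nn: "\<And>i j. 0 \<le> w i j" and pos: "\<And>i. degree w i > 0"
    and eig: "transition w v = \<rho> *\<^sub>R v" and "v \<noteq> 0"
  shows "\<bar>\<rho>\<bar> \<le> 1"
proof -
  obtain i where i: "\<And>j. \<bar>v $ j\<bar> \<le> \<bar>v $ i\<bar>"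
    using finite_type_attains_max[of "\<lambda>j. \<bar>v $ j\<bar>"] by blast
  have "v $ i \<noteq> 0"
  proof
    assume "v $ i = 0"
    then have "v $ j = 0" for j
      using i[of j] by simp
    with \<open>v \<noteq> 0\<close> show False
      by (simp add: vec_eq_iff)
  qed
  have "\<rho> * v $ i = (\<Sum>j\<in>UNIV. w i j * v $ j) / degree w i"
    using arg_cong[OF eig, of "\<lambda>v. v $ i"] by (simp add: transition_def)
  then have "(\<Sum>j\<in>UNIV. w i j * v $ j) = degree w i * (\<rho> * v $ i)"
    using pos[of i] by (simp add: field_simps)
  then have "degree w i * (\<bar>\<rho>\<bar> * \<bar>v $ i\<bar>) = \<bar>\<Sum>j\<in>UNIV. w i j * v $ j\<bar>"
    using pos[of i] by (simp add: abs_mult)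
  also have "\<dots> \<le> (\<Sum>j\<in>UNIV. w i j * \<bar>v $ i\<bar>)"
    using i nn by (intro order_trans[OF sum_abs] sum_mono) (simp add: abs_mult mult_left_mono)
  also have "\<dots> = degree w i * \<bar>v $ i\<bar>"
    by (simp add: degree_def sum_distrib_right)
  finally show ?thesis
    using pos[of i] \<open>v $ i \<noteq> 0\<close> by simp
qed

text \<open>At a vertex where \<open>v\<close> is maximal, the Laplacian is a vanishing sum of
  nonnegative terms, so every neighbor attains the maximum too. Connectedness spreads this to all
  vertices.\<close>

lemma transition_fixed_imp_constant:
  fixes w :: "'v::finite \<Rightarrow> 'v \<Rightarrow> real"
  assumes wg: "weighted_graph E w" and conn: "connected_graph E"
    and pos: "\<And>i. degree w i > 0" and fixed: "transition w v = v"
  shows "v $ a = v $ b"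
proof -
  have nn: "0 \<le> w i j" for i j
    using wg unfolding weighted_graph_def by (metis less_eq_real_def order_refl)
  obtain m where m: "\<And>j. v $ j \<le> v $ m"
    using finite_type_attains_max[of "($) v"] by blast
  have step: "v $ j = v $ m" if "v $ i = v $ m" "(i, j) \<in> E" for i j
  proof -
    have "(laplace w v) $ i = 0"
      by (simp add: laplace_eq_transition[OF pos] fixed)
    then have "(\<Sum>j\<in>UNIV. w i j * (v $ i - v $ j)) = 0"
      using pos[of i] by (simp add: laplace_def)
    then have "w i j * (v $ i - v $ j) = 0"
      using nn m that(1) by (subst (asm) sum_nonneg_eq_0_iff) auto
    moreover have "w i j > 0"
      using wg that(2) by (simp add: weighted_graph_def)
    ultimately show ?thesis
      using that(1) by simp
  qed
  have eq: "v $ j = v $ m" for j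
  proof -
    have "(m, j) \<in> E\<^sup>*"
      using conn by (simp add: connected_graph_def)
    then show ?thesis
      by induction (auto intro: step)
  qed
  show ?thesis
    using eq[of a] eq[of b] by simp
qed

text \<open>A path to a second vertex starts with an edge at \<open>i\<close>. A single vertex
  without a loop would have degree 0.\<close>

lemma degree_pos:
  fixes w :: "'v::finite \<Rightarrow> 'v \<Rightarrow> real"
  assumes wg: "weighted_graph E w" and conn: "connected_graph E" and card: "CARD('v) \<ge> 2"
  shows "degree w i > 0"
proof -
  obtain j where "j \<noteq> i"
    using card by (metis card_le_Suc0_iff_eq finite not_less_eq_eq numeral_2_eq_2)
  moreover have "(i, j) \<in> E\<^sup>*"
    using conn by (simp add: connected_graph_def)
  ultimately obtain k where "(i, k) \<in> E"
    by (metis converse_rtranclE)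
  then have "w i k > 0" and "\<And>j. 0 \<le> w i j"
    using wg unfolding weighted_graph_def by (metis less_eq_real_def order_refl)+
  then show ?thesis
    unfolding degree_def by (intro sum_pos2[of _ k]) auto
qed

section \<open>The neighborhood graph\<close>

lemma nbhd_weight_1: "nbhd_weight w (Suc 0) i j = w i j"
  by (simp add: nbhd_weight_def)

lemma sum_lists_Suc:
  fixes g :: "'v::finite list \<Rightarrow> real"
  shows "(\<Sum>ks | length ks = Suc n. g ks) = (\<Sum>k\<in>UNIV. \<Sum>ks | length ks = n. g (k # ks))"
proof -
  have "{ks :: 'v list. length ks = Suc n} = (\<lambda>(k, ks). k # ks) ` (UNIV \<times> {ks. length ks = n})"
    by (auto simp: length_Suc_conv)
  then have "(\<Sum>ks | length ks = Suc n. g ks)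
      = (\<Sum>(k, ks)\<in>UNIV \<times> {ks. length ks = n}. g (k # ks))"
    by (simp add: sum.reindex inj_on_def case_prod_unfold)
  then show ?thesis
    by (simp add: sum.cartesian_product)
qed

text \<open>Splits off the first step of the walk, with \<open>k\<close> as first inner vertex. At
  \<open>l = 0\<close> the recursion would start from the meaningless value.\<close>

lemma nbhd_weight_Suc:
  assumes "l \<ge> 1"
  shows "nbhd_weight w (Suc l) i j = (\<Sum>k\<in>UNIV. w i k / degree w k * nbhd_weight w l k j)"
proof -
  obtain n where n: "l = Suc n"
    using assms by (cases l) auto
  have "nbhd_weight w (Suc l) i j = (\<Sum>k\<in>UNIV. \<Sum>ks | length ks = n.
      w i k / degree w k * ((\<Prod>k\<leftarrow>ks. 1 / degree w k) *
        (\<Prod>m<Suc n. w ((k # ks @ [j]) ! m) ((k # ks @ [j]) ! Suc m))))"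
    unfolding nbhd_weight_def n
    by (subst prod.lessThan_Suc_shift) (simp add: sum_lists_Suc mult_ac)
  then show ?thesis
    by (simp add: nbhd_weight_def n sum_distrib_left)
qed

text \<open>This is \<open>w[l] = D P\<^sup>l\<close> applied to a vector. In the induction, the
  factor \<open>1 / degree w k\<close> of the new inner vertex cancels the degree supplied by the
  induction hypothesis.\<close>

lemma nbhd_weight_transition:
  fixes w :: "'v::finite \<Rightarrow> 'v \<Rightarrow> real"
  assumes pos: "\<And>i. degree w i > 0" and "l \<ge> 1"
  shows "(\<Sum>j\<in>UNIV. nbhd_weight w l i j * v $ j) = degree w i * ((transition w ^^ l) v $ i)"
  using \<open>l \<ge> 1\<close>
proof (induction l arbitrary: i rule: dec_induct)
  case base
  then show ?case
    using pos[of i] by (simp add: nbhd_weight_1 transition_def)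
next
  case (step l)
  have "(\<Sum>j\<in>UNIV. nbhd_weight w (Suc l) i j * v $ j)
      = (\<Sum>j\<in>UNIV. \<Sum>k\<in>UNIV. w i k / degree w k * (nbhd_weight w l k j * v $ j))"
    by (simp add: nbhd_weight_Suc[OF step(1)] sum_distrib_right mult.assoc)
  also have "\<dots> = (\<Sum>k\<in>UNIV. \<Sum>j\<in>UNIV. w i k / degree w k * (nbhd_weight w l k j * v $ j))"
    by (rule sum.swap)
  also have "\<dots> = (\<Sum>k\<in>UNIV. w i k / degree w k * (degree w k * ((transition w ^^ l) v $ k)))"
    by (simp only: sum_distrib_left[symmetric] step(3))
  also have "\<dots> = (\<Sum>k\<in>UNIV. w i k * ((transition w ^^ l) v $ k))"
    using pos by (simp add: less_imp_neq[symmetric])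
  also have "\<dots> = degree w i * ((transition w ^^ Suc l) v $ i)"
    using pos[of i] by (simp add: transition_def)
  finally show ?case .
qed

text \<open>The row sums of \<open>D P\<^sup>l\<close> are its values on the constant function 1,
  which \<open>P\<close> fixes.\<close>

lemma degree_nbhd_weight:
  fixes w :: "'v::finite \<Rightarrow> 'v \<Rightarrow> real"
  assumes pos: "\<And>i. degree w i > 0" and "l \<ge> 1"
  shows "degree (nbhd_weight w l) i = degree w i"
proof -
  have "(transition w ^^ n) 1 = 1" for n
    by (induction n) (simp_all add: transition_one[OF pos])
  then show ?thesis
    using nbhd_weight_transition[OF assms, of i 1] by (simp add: degree_def)
qed

lemma transition_nbhd_weight:
  fixes w :: "'v::finite \<Rightarrow> 'v \<Rightarrow> real"
  assumes "\<And>i. degree w i > 0" and "l \<ge> 1"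
  shows "transition (nbhd_weight w l) v = (transition w ^^ l) v"
  using assms(1)
  by (simp add: transition_def[of "nbhd_weight w l"] nbhd_weight_transition[OF assms]
      degree_nbhd_weight[OF assms] vec_eq_iff less_imp_neq[symmetric])

section \<open>Eigenvalue bounds\<close>

lemma linear_laplace:
  assumes "\<And>i. degree w i > 0"
  shows "linear (laplace w)"
  unfolding laplace_eq_transition[OF assms, abs_def]
  by (intro linear_compose_sub linear_ident linear_transition)

text \<open>The eigenspace for 1 consists of the constants and has dimension 1, so exactly one basis
  vector \<open>e\<close> belongs to it. It accounts for the eigenvalue 0 that is split off from
  both spectra.\<close>

lemma transition_eigenbasis_connected:
  fixes w :: "'v::finite \<Rightarrow> 'v \<Rightarrow> real"
  assumes wg: "weighted_graph E w" and conn: "connected_graph E" and card: "CARD('v) \<ge> 2"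
  obtains B \<rho> e where "independent B" "span B = UNIV"
    "\<And>b. b \<in> B \<Longrightarrow> transition w b = \<rho> b *\<^sub>R b" "\<And>b. b \<in> B \<Longrightarrow> \<bar>\<rho> b\<bar> \<le> 1"
    "e \<in> B" "\<rho> e = 1" "\<And>b. b \<in> B - {e} \<Longrightarrow> \<rho> b < 1"
proof -
  note pos = degree_pos[OF assms]
  have sym: "w i j = w j i" for i j
    using wg by (simp add: weighted_graph_def)
  have nn: "0 \<le> w i j" for i j
    using wg unfolding weighted_graph_def by (metis less_eq_real_def order_refl)
  obtain B \<rho> where B: "independent B" "span B = UNIV"
    and eig: "\<And>b. b \<in> B \<Longrightarrow> transition w b = \<rho> b *\<^sub>R b"
    using transition_eigenbasis_exists[OF sym pos] by metis
  have le1: "\<bar>\<rho> b\<bar> \<le> 1" if "b \<in> B" for b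
    using transition_eigenvalue_abs_le_1[OF nn pos eig[OF that]] that B(1) dependent_zero by blast
  have es: "eigenspace (transition w) 1 = span {b \<in> B. \<rho> b = 1}"
    by (rule eigenspace_eq_span[OF linear_transition B eig])
  have "eigenspace (transition w) 1 = span {1}"
  proof
    show "eigenspace (transition w) 1 \<subseteq> span {1}"
    proof
      fix v assume "v \<in> eigenspace (transition w) 1"
      then have "transition w v = v"
        by (simp add: eigenspace_def)
      then have "v $ a = v $ b" for a b
        by (rule transition_fixed_imp_constant[OF wg conn pos])
      then have "v = (v $ undefined) *\<^sub>R 1"
        by (simp add: vec_eq_iff)
      then show "v \<in> span {1}"
        by (metis span_base span_scale singletonI)
    qed
    show "span {1} \<subseteq> eigenspace (transition w) 1"
      by (auto simp: span_singleton eigenspace_def linear_scale[OF linear_transition]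
          transition_one[OF pos])
  qed
  then have "dim (span {b \<in> B. \<rho> b = 1}) = dim (span {1 :: real ^ 'v})"
    using es by simp
  moreover have "independent {b \<in> B. \<rho> b = 1}"
    using B(1) by (rule independent_mono) auto
  moreover have "independent {1 :: real ^ 'v}"
    by (simp add: dependent_single)
  ultimately have "card {b \<in> B. \<rho> b = 1} = 1"
    by (simp add: dim_eq_card_independent)
  then obtain e where e: "{b \<in> B. \<rho> b = 1} = {e}"
    by (auto simp: card_1_singleton_iff)
  have "\<rho> b < 1" if "b \<in> B - {e}" for b
  proof -
    have "\<rho> b \<noteq> 1"
      using e that by blast
    then show ?thesis
      using le1[of b] that by (simp add: abs_le_iff)
  qed
  moreover have "e \<in> B" "\<rho> e = 1"
    using e by blast+
  ultimately show ?thesis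
    using that B eig le1 by metis
qed

theorem theorem5p3:
  fixes E :: "('v::finite \<times> 'v) set"
    and w :: "'v \<Rightarrow> 'v \<Rightarrow> real"
    and l :: nat
    and A :: real
  defines "N \<equiv> CARD('v)"
    and "ev \<equiv> spectrum_list (laplace w)"
    and "evl \<equiv> spectrum_list (laplace (nbhd_weight w l))"
  assumes "weighted_graph E w"
    and "connected_graph E"
    and "N \<ge> 2"
    and "l \<ge> 1"
    and "A \<le> evl ! 1"
  shows "length ev = N \<and> ev ! 0 = 0 \<and> 0 < ev ! 1 \<and>
    (\<forall>k. 1 \<le> k \<and> k + 1 < N \<longrightarrow> ev ! k \<le> ev ! (k + 1)) \<and>
    (even l \<longrightarrow> 1 - root l (1 - A) \<le> ev ! 1 \<and> ev ! (N - 1) \<le> 1 + root l (1 - A)) \<and>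
    (odd l \<longrightarrow> 1 - root l (1 - A) \<le> ev ! 1)"
proof -
  have card: "CARD('v) \<ge> 2"
    using \<open>N \<ge> 2\<close> by (simp add: N_def)
  note graph = \<open>weighted_graph E w\<close> \<open>connected_graph E\<close> card
  note pos = degree_pos[OF graph]
  have posl: "degree (nbhd_weight w l) i > 0" for i
    using pos by (simp add: degree_nbhd_weight[OF pos \<open>l \<ge> 1\<close>])
  obtain B \<rho> e where B: "independent B" "span B = UNIV"
    and eig: "\<And>b. b \<in> B \<Longrightarrow> transition w b = \<rho> b *\<^sub>R b"
    and abs_le: "\<And>b. b \<in> B \<Longrightarrow> \<bar>\<rho> b\<bar> \<le> 1"
    and e: "e \<in> B" "\<rho> e = 1" and less: "\<And>b. b \<in> B - {e} \<Longrightarrow> \<rho> b < 1"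
    using transition_eigenbasis_connected[OF graph] by metis
  have fin: "finite B"
    using B(1) by (rule independent_imp_finite)
  have cardB: "card B = N"
    using B dim_eq_card_independent[OF B(1)] by (metis N_def dim_UNIV dim_span DIM_cart DIM_real mult_1_right)

  \<comment> \<open>The same vector \<open>e\<close> is removed for both operators, so both tails
    run over the same basis vectors, although sorting may order them differently.\<close>
  define rest where "rest g = sorted_list_of_multiset (image_mset g (mset_set (B - {e})))"
    for g :: "real ^ 'v \<Rightarrow> real"
  have set_rest: "set (rest g) = g ` (B - {e})" for g
    using fin by (simp add: rest_def)
  have sorted_rest: "sorted (rest g)" for g
    by (simp add: rest_def)
  have length_rest: "length (rest g) = N - 1" for g
    using fin e(1) cardB
    by (metis rest_def mset_sorted_list_of_multiset size_mset size_image_mset size_mset_set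
        card_Diff_singleton)
  \<comment> \<open>The value at \<open>e\<close> is a minimum and may be put first, even if 0
    occurs again. Entry 1 of the list is then the minimum of \<open>g\<close> over
    \<open>B - {e}\<close>.\<close>
  have split: "sorted_list_of_multiset (image_mset g (mset_set B)) = 0 # rest g"
    if "g e = 0" "\<And>b. b \<in> B \<Longrightarrow> 0 \<le> g b" for g
  proof -
    have "image_mset g (mset_set B) = add_mset 0 (image_mset g (mset_set (B - {e})))"
      using mset_set.remove[OF fin e(1)] that(1) by simp
    then show ?thesis
      unfolding rest_def using that(2) fin
      by (simp only:) (rule sorted_list_of_multiset_Cons, auto)
  qed

  have "laplace w b = (1 - \<rho> b) *\<^sub>R b" if "b \<in> B" for b
    by (simp add: laplace_eq_transition[OF pos] eig[OF that] algebra_simps)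
  then have "ev = sorted_list_of_multiset (image_mset (\<lambda>b. 1 - \<rho> b) (mset_set B))"
    unfolding ev_def by (rule spectrum_list_eigenbasis[OF linear_laplace[OF pos] B])
  also have "\<dots> = 0 # rest (\<lambda>b. 1 - \<rho> b)"
    using e abs_le by (intro split) (auto simp: abs_le_iff)
  finally have ev: "ev = 0 # rest (\<lambda>b. 1 - \<rho> b)" .

  have pow: "(transition w ^^ n) b = \<rho> b ^ n *\<^sub>R b" if "b \<in> B" for b n
    by (induction n) (simp_all add: linear_scale[OF linear_transition] eig[OF that])
  have pow_le: "\<rho> b ^ l \<le> 1" if "b \<in> B" for b
  proof -
    have "\<bar>\<rho> b ^ l\<bar> \<le> 1"
      using abs_le[OF that] by (simp add: power_abs power_le_one)
    then show ?thesis
      by simp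
  qed
  have "laplace (nbhd_weight w l) b = (1 - \<rho> b ^ l) *\<^sub>R b" if "b \<in> B" for b
    by (simp add: laplace_eq_transition[OF posl] transition_nbhd_weight[OF pos \<open>l \<ge> 1\<close>]
        pow[OF that] algebra_simps)
  then have "evl = sorted_list_of_multiset (image_mset (\<lambda>b. 1 - \<rho> b ^ l) (mset_set B))"
    unfolding evl_def by (rule spectrum_list_eigenbasis[OF linear_laplace[OF posl] B])
  also have "\<dots> = 0 # rest (\<lambda>b. 1 - \<rho> b ^ l)"
    using e pow_le by (intro split) auto
  finally have evl: "evl = 0 # rest (\<lambda>b. 1 - \<rho> b ^ l)" .

  \<comment> \<open>The head of the sorted tail bounds every entry from below. A second eigenvalue
    0, as for even \<open>l\<close> with some \<open>\<rho> b = -1\<close>, is covered.\<close>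
  have key: "\<rho> b ^ l \<le> 1 - A" if "b \<in> B - {e}" for b
  proof -
    have "1 - \<rho> b ^ l \<in> set (rest (\<lambda>b. 1 - \<rho> b ^ l))"
      using that by (auto simp: set_rest)
    then have "rest (\<lambda>b. 1 - \<rho> b ^ l) ! 0 \<le> 1 - \<rho> b ^ l"
      using sorted_rest sorted_nth_mono by (metis in_set_conv_nth le0)
    then show ?thesis
      using \<open>A \<le> evl ! 1\<close> by (simp add: evl)
  qed
  \<comment> \<open>For odd \<open>l\<close> the root inverts the power on all reals and keeps
    signs, so only a one-sided bound results.\<close>
  have odd_bound: "\<rho> b \<le> root l (1 - A)" if "b \<in> B - {e}" "odd l" for b
    using key[OF that(1)] that(2) \<open>l \<ge> 1\<close> real_root_le_mono[of l "\<rho> b ^ l" "1 - A"]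
    by (simp add: odd_real_root_power_cancel)
  \<comment> \<open>For even \<open>l\<close> the power sees only
    \<open>\<bar>\<rho> b\<bar>\<close>, which yields both bounds. Here \<open>key\<close> also
    gives \<open>1 - A \<ge> 0\<close>, so the root is the usual nonnegative one.\<close>
  have even_bound: "\<bar>\<rho> b\<bar> \<le> root l (1 - A)" if "b \<in> B - {e}" "even l" for b
  proof -
    have "root l (\<bar>\<rho> b\<bar> ^ l) \<le> root l (1 - A)"
      using key[OF that(1)] that(2) \<open>l \<ge> 1\<close> by (intro real_root_le_mono) (auto simp: power_even_abs)
    then show ?thesis
      using \<open>l \<ge> 1\<close> real_root_power_cancel[of l "\<bar>\<rho> b\<bar>"] by simp
  qed

  \<comment> \<open>Entry \<open>k\<close> of \<open>ev\<close> is entry \<open>k - 1\<close> of the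
    tail. The last index \<open>N - 1\<close> is included because \<open>N \<ge> 2\<close>.\<close>
  have nth: "\<exists>b\<in>B - {e}. ev ! k = 1 - \<rho> b" if "1 \<le> k" "k < N" for k
  proof -
    have "rest (\<lambda>b. 1 - \<rho> b) ! (k - 1) \<in> set (rest (\<lambda>b. 1 - \<rho> b))"
      using that by (intro nth_mem) (simp add: length_rest)
    then show ?thesis
      using that(1) by (auto simp: ev set_rest nth_Cons')
  qed
  have len: "length ev = N"
    using \<open>N \<ge> 2\<close> by (simp add: ev length_rest)
  have "sorted ev"
    by (simp add: ev_def spectrum_list_def)
  then have "\<forall>k. 1 \<le> k \<and> k + 1 < N \<longrightarrow> ev ! k \<le> ev ! (k + 1)"
    by (simp add: len sorted_nth_mono)
  moreover obtain b where b: "b \<in> B - {e}" "ev ! 1 = 1 - \<rho> b"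
    using nth[of 1] \<open>N \<ge> 2\<close> by auto
  moreover obtain c where c: "c \<in> B - {e}" "ev ! (N - 1) = 1 - \<rho> c"
  proof -
    have "1 \<le> N - 1" "N - 1 < N"
      using \<open>N \<ge> 2\<close> by auto
    then show ?thesis
      using nth that by blast
  qed
  moreover have "ev ! 0 = 0"
    by (simp add: ev)
  ultimately show ?thesis
    using len less[OF b(1)] odd_bound[OF b(1)] even_bound[OF b(1)] even_bound[OF c(1)]
    by (auto simp: abs_le_iff)
qed

end
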